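(* Let $(X,\mu,\ast)$ be a fuzzy metric space and let $A,B,S,T:X\to X$ be self-mappings satisfying: $$A(X)\subset T(X)\quad\text{and}\quad B(X)\subset S(X),$$ and, for all $x,y\in X$ and all $t>0$, $$F\big(\mu(Ax,By,t),\ \mu(Sx,Ty,t),\ \mu(Ax,Sx,t),\ \mu(By,Ty,t),\ \mu(Sx,By,t),\ \mu(Ax,Ty,t)\big)\le 1,$$ where $F:[0,1]^6\to\mathbb{R}$ is a continuous function satisfying properties $(F_1)$, $(F_2)$ and $(F_3)$. Suppose that $(A,S)$ or $(B,T)$ satisfies property (E.A.), and that the pairs $(A,S)$ and $(B,T)$ are weakly compatible. If the range of one of $A,B,S,T$ is a closed subset of $X$, then $A$, $B$, $S$ and $T$ have a unique common fixed point in $X$.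
   Context: Continuous t-norm: a binary operation $\ast:[0,1]\times[0,1]\to[0,1]$ that is commutative, associative, continuous, satisfies $a\ast 1=a$ for all $a\in[0,1]$, and satisfies $a\ast b\le c\ast d$ whenever $a\le c$, $b\le d$ ($a,b,c,d\in[0,1]$). Fuzzy metric space: a triple $(X,\mu,\ast)$ where $X$ is a set, $\ast$ is a continuous t-norm and $\mu:X^2\times(0,\infty)\to[0,1]$ satisfies, for all $x,y,z\in X$ and $s,t>0$: (i) $\mu(x,y,t)>0$; (ii) $\mu(x,y,t)=1$ if and only if $x=y$; (iii) $\mu(x,y,t)=\mu(y,x,t)$; (iv) $\mu(x,y,s)\ast\mu(y,z,t)\le\mu(x,z,s+t)$; (v) $\mu(x,y,\cdot):(0,\infty)\to(0,1]$ is continuous. Convergence: $x_n\to x$ means $\lim_{n\to\infty}\mu(x_n,x,t)=1$ for every $t>0$. A subset $P\subseteq X$ is closed if whenever a sequence in $P$ converges to $x\in X$, then $x\in P$. Weak compatibility: self-maps $A$ and $B$ of $X$ are weakly compatible if they commute at their coincidence points: $Az=Bz$ implies $ABz=BAz$. Property (E.A.): a pair $(A,B)$ of self-maps of $X$ satisfies property (E.A.) if there is a sequence $(x_n)$ in $X$ such that $\lim_{n\to\infty}Ax_n=\lim_{n\to\infty}Bx_n=z$ for some $z\in X$. Properties of $F$ (a continuous function on $[0,1]^6$): $(F_1)$ $F(u(t),1,1,u(t),u(t),1)>1$ for all $t>0$ with $0\le u(t)<1$; $(F_2)$ $F(u(t),1,u(t),1,1,u(t))>1$ for all $t>0$ with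 $0\le u(t)<1$; $(F_3)$ $F(u(t),u(t),1,1,u(t),u(t))>1$ for all $t>0$ with $0\le u(t)<1$. (That is, for every real number $u\in[0,1)$ in place of $u(t)$.) *)

theory Defs
  imports "HOL-Analysis.Analysis"
begin

locale continuous_t_norm =
  fixes star :: "real \<Rightarrow> real \<Rightarrow> real" (infixl "\<ast>" 70)
  assumes closed: "a \<in> {0..1} \<Longrightarrow> b \<in> {0..1} \<Longrightarrow> a \<ast> b \<in> {0..1}"
    and commute: "a \<in> {0..1} \<Longrightarrow> b \<in> {0..1} \<Longrightarrow> a \<ast> b = b \<ast> a"
    and assoc: "a \<in> {0..1} \<Longrightarrow> b \<in> {0..1} \<Longrightarrow> c \<in> {0..1} \<Longrightarrow> (a \<ast> b) \<ast> c = a \<ast> (b \<ast> c)"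
    and continuous: "continuous_on ({0..1} \<times> {0..1}) (\<lambda>(a, b). a \<ast> b)"
    and right_unit: "a \<in> {0..1} \<Longrightarrow> a \<ast> 1 = a"
    and mono: "a \<in> {0..1} \<Longrightarrow> b \<in> {0..1} \<Longrightarrow> c \<in> {0..1} \<Longrightarrow> d \<in> {0..1} \<Longrightarrow>
      a \<le> c \<Longrightarrow> b \<le> d \<Longrightarrow> a \<ast> b \<le> c \<ast> d"

text \<open>The values of \<open>\<mu>\<close> outside \<open>X \<times> X \<times> (0,\<infinity>)\<close> and of the t-norm outside the unit square
  are unconstrained; everything below is relativised to these domains.\<close>

locale fuzzy_metric_space = continuous_t_norm star
  for X :: "'a set" and \<mu> :: "'a \<Rightarrow> 'a \<Rightarrow> real \<Rightarrow> real"
    and star :: "real \<Rightarrow> real \<Rightarrow> real" (infixl "\<ast>" 70) +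
  assumes le_one: "x \<in> X \<Longrightarrow> y \<in> X \<Longrightarrow> t > 0 \<Longrightarrow> \<mu> x y t \<le> 1"
    and pos: "x \<in> X \<Longrightarrow> y \<in> X \<Longrightarrow> t > 0 \<Longrightarrow> \<mu> x y t > 0"
    and eq_one_iff: "x \<in> X \<Longrightarrow> y \<in> X \<Longrightarrow> t > 0 \<Longrightarrow> \<mu> x y t = 1 \<longleftrightarrow> x = y"
    and sym: "x \<in> X \<Longrightarrow> y \<in> X \<Longrightarrow> t > 0 \<Longrightarrow> \<mu> x y t = \<mu> y x t"
    and triangle: "x \<in> X \<Longrightarrow> y \<in> X \<Longrightarrow> z \<in> X \<Longrightarrow> s > 0 \<Longrightarrow> t > 0 \<Longrightarrow>
      \<mu> x y s \<ast> \<mu> y z t \<le> \<mu> x z (s + t)"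
    and continuous_time: "x \<in> X \<Longrightarrow> y \<in> X \<Longrightarrow> continuous_on {0<..} (\<mu> x y)"

definition fuzzy_converges :: "('a \<Rightarrow> 'a \<Rightarrow> real \<Rightarrow> real) \<Rightarrow> (nat \<Rightarrow> 'a) \<Rightarrow> 'a \<Rightarrow> bool" where
  "fuzzy_converges \<mu> x l \<longleftrightarrow> (\<forall>t>0. (\<lambda>n. \<mu> (x n) l t) \<longlonglongrightarrow> 1)"

definition fuzzy_closed :: "'a set \<Rightarrow> ('a \<Rightarrow> 'a \<Rightarrow> real \<Rightarrow> real) \<Rightarrow> 'a set \<Rightarrow> bool" where
  "fuzzy_closed X \<mu> P \<longleftrightarrow>
    P \<subseteq> X \<and> (\<forall>x l. (\<forall>n. x n \<in> P) \<and> l \<in> X \<and> fuzzy_converges \<mu> x l \<longrightarrow> l \<in> P)"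

definition weakly_compatible :: "'a set \<Rightarrow> ('a \<Rightarrow> 'a) \<Rightarrow> ('a \<Rightarrow> 'a) \<Rightarrow> bool" where
  "weakly_compatible X A B \<longleftrightarrow> (\<forall>z\<in>X. A z = B z \<longrightarrow> A (B z) = B (A z))"

definition property_EA ::
  "'a set \<Rightarrow> ('a \<Rightarrow> 'a \<Rightarrow> real \<Rightarrow> real) \<Rightarrow> ('a \<Rightarrow> 'a) \<Rightarrow> ('a \<Rightarrow> 'a) \<Rightarrow> bool" where
  "property_EA X \<mu> A B \<longleftrightarrow>
    (\<exists>x z. (\<forall>n. x n \<in> X) \<and> z \<in> X \<and>
      fuzzy_converges \<mu> (\<lambda>n. A (x n)) z \<and> fuzzy_converges \<mu> (\<lambda>n. B (x n)) z)"

type_synonym real6 = "real \<times> real \<times> real \<times> real \<times> real \<times> real"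

abbreviation unit_cube6 :: "real6 set" where
  "unit_cube6 \<equiv> {0..1} \<times> {0..1} \<times> {0..1} \<times> {0..1} \<times> {0..1} \<times> {0..1}"

text \<open>These conditions are usually written with \<open>u(t) \<in> [0,1)\<close> for all \<open>t > 0\<close>; since \<open>u\<close> is
  arbitrary, they are pointwise conditions on all reals \<open>u \<in> [0,1)\<close>.\<close>

definition property_F1 :: "(real6 \<Rightarrow> real) \<Rightarrow> bool" where
  "property_F1 F \<longleftrightarrow> (\<forall>u\<in>{0..<1}. F (u, 1, 1, u, u, 1) > 1)"

definition property_F2 :: "(real6 \<Rightarrow> real) \<Rightarrow> bool" where
  "property_F2 F \<longleftrightarrow> (\<forall>u\<in>{0..<1}. F (u, 1, u, 1, 1, u) > 1)"

definition property_F3 :: "(real6 \<Rightarrow> real) \<Rightarrow> bool" where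
  "property_F3 F \<longleftrightarrow> (\<forall>u\<in>{0..<1}. F (u, u, 1, 1, u, u) > 1)"

end

theory Submission
  imports Defs
begin

text \<open>
  The hypotheses are invariant under exchanging \<open>(A, S)\<close> with \<open>(B, T)\<close>, provided the last two
  pairs of arguments of \<open>F\<close> are exchanged as well; this turns \<open>F\<^sub>1\<close> into \<open>F\<^sub>2\<close> and preserves \<open>F\<^sub>3\<close>.
  The arguments are therefore given for one pair and transported to the other one
  (lemma \<open>exchange_pairs\<close>).

  Let \<open>B x\<^sub>n\<close> and \<open>T x\<^sub>n\<close> tend to \<open>z\<close>, and write \<open>B x\<^sub>n = S y\<^sub>n\<close>. The heart of the proof is
  that \<open>A y\<^sub>n\<close> tends to \<open>z\<close> too. One would like to let \<open>n\<close> tend to infinity in the contractive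
  inequality and to quote \<open>F\<^sub>2\<close>, but \<open>\<mu> (A y\<^sub>n) (B x\<^sub>n) t\<close> and \<open>\<mu> (A y\<^sub>n) (T x\<^sub>n) t\<close> may fail to have
  a common limit: the triangle inequality compares the two only after a shift of the time, and
  \<open>\<mu> p q\<close> is continuous in time for each pair of points, not uniformly over all pairs.
  The remedy is to look at the lower limit of \<open>\<mu> (A y\<^sub>n) (B x\<^sub>n) t\<close> as a function of \<open>t\<close>.
  It is monotone, hence continuous off a countable set; at a time where it is continuous small
  shifts are harmless, so that along some indices both quantities do approach it, and \<open>F\<^sub>2\<close> forces
  it to be \<open>1\<close>. By monotonicity it is \<open>1\<close> at all times (lemma \<open>nearness_forced_by_F2\<close>).

  So \<open>A y\<^sub>n\<close>, \<open>S y\<^sub>n\<close>, \<open>B x\<^sub>n\<close>, \<open>T x\<^sub>n\<close> have the same limit \<open>z\<close>. A closed range among the four contains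
  \<open>z\<close>, hence \<open>z\<close> is in the range of \<open>S\<close> or of \<open>T\<close>. If \<open>z = S a\<close>, the contractive inequality
  for \<open>a\<close> and \<open>x\<^sub>n\<close> gives \<open>A a = z\<close> in the limit, and then \<open>z\<close> lies in the range of \<open>A\<close>, hence of \<open>T\<close>,
  and the exchanged argument applies to \<open>T\<close> and \<open>B\<close>. Weak compatibility makes
  \<open>z\<close> itself a coincidence point of both pairs, and \<open>F\<^sub>3\<close> identifies any two values
  \<open>A a = S a\<close> and \<open>B b = T b\<close>; this gives fixedness and uniqueness together.
\<close>

section \<open>Comparing distances in a fuzzy metric space\<close>

text \<open>Uniformity in \<open>a\<close> comes from compactness of the unit square. It matters because the lemma is
  applied to sequences \<open>a\<close> that need not converge.\<close>

lemma (in continuous_t_norm) almost_right_unit: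
  assumes "e > 0"
  shows "\<exists>d>0. \<forall>a\<in>{0..1}. \<forall>b\<in>{0..1}. b > 1 - d \<longrightarrow> a \<ast> b > a - e"
proof -
  have "uniformly_continuous_on ({0..1} \<times> {0..1}) (\<lambda>(a, b). a \<ast> b)"
    using continuous by (intro compact_uniformly_continuous compact_Times) auto
  then obtain d where d: "d > 0"
    and close: "\<And>p q. p \<in> {0..1} \<times> {0..1} \<Longrightarrow> q \<in> {0..1} \<times> {0..1} \<Longrightarrow> dist q p < d
      \<Longrightarrow> dist ((\<lambda>(a, b). a \<ast> b) q) ((\<lambda>(a, b). a \<ast> b) p) < e"
    unfolding uniformly_continuous_on_def using assms by meson
  have "a \<ast> b > a - e" if a: "a \<in> {0..1}" and b: "b \<in> {0..1}" "b > 1 - d" for a b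
  proof -
    have "dist (a, b) (a, 1) < d"
      using b by (simp add: dist_prod_def dist_real_def)
    then have "dist (a \<ast> b) (a \<ast> 1) < e"
      using close[of "(a, 1)" "(a, b)"] a b(1) by simp
    then show ?thesis
      using right_unit[OF a] by (simp add: dist_real_def abs_if split: if_splits)
  qed
  with d show ?thesis by blast
qed

context fuzzy_metric_space
begin

lemma in_unit: "x \<in> X \<Longrightarrow> y \<in> X \<Longrightarrow> t > 0 \<Longrightarrow> \<mu> x y t \<in> {0..1}"
  using le_one pos by (simp add: less_imp_le)

lemma mono_time:
  assumes "x \<in> X" "y \<in> X" "0 < s" "s \<le> t"
  shows "\<mu> x y s \<le> \<mu> x y t"
proof (cases "s = t")
  case False
  then have "\<mu> x y s \<ast> \<mu> y y (t - s) \<le> \<mu> x y (s + (t - s))"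
    using assms by (intro triangle) auto
  moreover have "\<mu> y y (t - s) = 1"
    using assms False by (simp add: eq_one_iff)
  ultimately show ?thesis
    using right_unit in_unit assms by simp
qed simp

text \<open>Replacing \<open>q\<^sub>n\<close> by a nearby \<open>r\<^sub>n\<close> costs an arbitrarily small delay \<open>s\<close> and an arbitrarily small
  error \<open>e\<close>, whatever the sequence \<open>p\<^sub>n\<close> does.\<close>

lemma eventually_replace_right:
  assumes "\<And>n. p n \<in> X" "\<And>n. q n \<in> X" "\<And>n. r n \<in> X"
    and near: "(\<lambda>n. \<mu> (q n) (r n) s) \<longlonglongrightarrow> 1"
    and "s > 0" "t > 0" "e > 0"
  shows "\<forall>\<^sub>F n in sequentially. \<mu> (p n) (q n) t - e < \<mu> (p n) (r n) (t + s)"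
proof -
  obtain d where "d > 0"
    and d: "\<And>a b. a \<in> {0..1} \<Longrightarrow> b \<in> {0..1} \<Longrightarrow> b > 1 - d \<Longrightarrow> a \<ast> b > a - e"
    using almost_right_unit[OF \<open>e > 0\<close>] by blast
  have "\<forall>\<^sub>F n in sequentially. 1 - d < \<mu> (q n) (r n) s"
    using near \<open>d > 0\<close> by (intro order_tendstoD(1)) auto
  then show ?thesis
  proof eventually_elim
    case (elim n)
    have "\<mu> (p n) (q n) t - e < \<mu> (p n) (q n) t \<ast> \<mu> (q n) (r n) s"
      using elim assms in_unit by (intro d) auto
    also have "\<dots> \<le> \<mu> (p n) (r n) (t + s)"
      using assms by (intro triangle) auto
    finally show ?case .
  qed
qed

lemma tendsto_one_trans:
  assumes "\<And>n. p n \<in> X" "\<And>n. q n \<in> X" "\<And>n. r n \<in> X"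
    and pq: "\<And>t. t > 0 \<Longrightarrow> (\<lambda>n. \<mu> (p n) (q n) t) \<longlonglongrightarrow> 1"
    and qr: "\<And>t. t > 0 \<Longrightarrow> (\<lambda>n. \<mu> (q n) (r n) t) \<longlonglongrightarrow> 1"
    and "t > 0"
  shows "(\<lambda>n. \<mu> (p n) (r n) t) \<longlonglongrightarrow> 1"
proof (rule order_tendstoI)
  fix c :: real assume "c < 1"
  define e where "e = (1 - c) / 2"
  have "e > 0" using \<open>c < 1\<close> by (simp add: e_def)
  have "\<forall>\<^sub>F n in sequentially. \<mu> (p n) (q n) (t/2) - e < \<mu> (p n) (r n) (t/2 + t/2)"
    using assms \<open>e > 0\<close> by (intro eventually_replace_right) auto
  moreover have "\<forall>\<^sub>F n in sequentially. 1 - e < \<mu> (p n) (q n) (t/2)"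
    using pq[of "t/2"] \<open>t > 0\<close> \<open>e > 0\<close> by (intro order_tendstoD(1)) auto
  ultimately show "\<forall>\<^sub>F n in sequentially. c < \<mu> (p n) (r n) t"
    by eventually_elim (simp add: e_def field_simps)
next
  fix c :: real assume "1 < c"
  then show "\<forall>\<^sub>F n in sequentially. \<mu> (p n) (r n) t < c"
    using assms le_one by (intro always_eventually allI) (meson le_less_trans)
qed

lemma tendsto_one_of_common_limit:
  assumes "\<And>n. p n \<in> X" "\<And>n. q n \<in> X" "z \<in> X"
    and "fuzzy_converges \<mu> p z" "fuzzy_converges \<mu> q z" "t > 0"
  shows "(\<lambda>n. \<mu> (p n) (q n) t) \<longlonglongrightarrow> 1"
proof (rule tendsto_one_trans[where q = "\<lambda>_. z"])
  show "(\<lambda>n. \<mu> z (q n) s) \<longlonglongrightarrow> 1" if "s > 0" for s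
    using assms that sym[OF assms(3,2) that] by (simp add: fuzzy_converges_def)
qed (use assms in \<open>auto simp: fuzzy_converges_def\<close>)

text \<open>Here the time shifts can be undone, because \<open>\<mu> w z\<close> is a single function, continuous in time.\<close>

lemma tendsto_of_converges:
  assumes "w \<in> X" "\<And>n. q n \<in> X" "z \<in> X" and conv: "fuzzy_converges \<mu> q z" and "t > 0"
  shows "(\<lambda>n. \<mu> w (q n) t) \<longlonglongrightarrow> \<mu> w z t"
proof (rule LIMSEQ_I)
  fix e :: real assume "e > 0"
  have qz: "(\<lambda>n. \<mu> (q n) z s) \<longlonglongrightarrow> 1" and zq: "(\<lambda>n. \<mu> z (q n) s) \<longlonglongrightarrow> 1" if "s > 0" for s
    using assms that sym[OF assms(3,2) that] by (simp_all add: fuzzy_converges_def)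
  have "isCont (\<mu> w z) t"
    using continuous_time[of w z] assms by (simp add: continuous_on_eq_continuous_at)
  then obtain d where "d > 0" and d: "\<And>t'. \<bar>t' - t\<bar> < d \<Longrightarrow> \<bar>\<mu> w z t' - \<mu> w z t\<bar> < e/2"
    unfolding continuous_at_eps_delta using \<open>e > 0\<close>
    by (metis dist_real_def half_gt_zero)
  define s where "s = min d t / 2"
  have s: "0 < s" "s < t" "s < d" using \<open>d > 0\<close> \<open>t > 0\<close> by (auto simp: s_def)
  have "\<forall>\<^sub>F n in sequentially. \<mu> w z (t - s) - e/2 < \<mu> w (q n) (t - s + s)"
    using assms s \<open>e > 0\<close> zq by (intro eventually_replace_right) auto
  moreover have "\<forall>\<^sub>F n in sequentially. \<mu> w (q n) t - e/2 < \<mu> w z (t + s)"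
    using assms s \<open>e > 0\<close> qz by (intro eventually_replace_right) auto
  ultimately have "\<forall>\<^sub>F n in sequentially. norm (\<mu> w (q n) t - \<mu> w z t) < e"
  proof eventually_elim
    case (elim n)
    then show ?case using d[of "t - s"] d[of "t + s"] s by (auto simp: abs_if split: if_splits)
  qed
  then show "\<exists>no. \<forall>n\<ge>no. norm (\<mu> w (q n) t - \<mu> w z t) < e"
    by (simp add: eventually_sequentially)
qed

end

section \<open>Limits in implicit inequalities\<close>

lemma implicit_inequality_limit:
  fixes F :: "real6 \<Rightarrow> real"
  assumes "continuous_on unit_cube6 F"
    and "\<And>n. (a n, b n, c n, d n, e n, f n) \<in> unit_cube6"
    and "\<And>n. F (a n, b n, c n, d n, e n, f n) \<le> 1"
    and "a \<longlonglongrightarrow> a'" "b \<longlonglongrightarrow> b'" "c \<longlonglongrightarrow> c'" "d \<longlonglongrightarrow> d'" "e \<longlonglongrightarrow> e'" "f \<longlonglongrightarrow> f'"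
  shows "F (a', b', c', d', e', f') \<le> 1"
proof (rule LIMSEQ_le_const2)
  let ?v = "\<lambda>n. (a n, b n, c n, d n, e n, f n)"
  have lim: "?v \<longlonglongrightarrow> (a', b', c', d', e', f')"
    using assms by (intro tendsto_intros)
  moreover have "closed unit_cube6"
    by (intro closed_Times) auto
  ultimately have "(a', b', c', d', e', f') \<in> unit_cube6"
    using assms(2) closed_sequentially by meson
  then show "(\<lambda>n. F (?v n)) \<longlonglongrightarrow> F (a', b', c', d', e', f')"
    using assms(2) by (intro continuous_on_tendsto_compose[OF assms(1) lim]) auto
qed (use assms(3) in blast)

text \<open>The sequence \<open>p\<close> need not converge, so \<open>\<mu> (p n) (q n) t\<close> and \<open>\<mu> (p n) (r n) t\<close> can only be
  compared across a small change of time. This suffices at the times where the lower limit of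
  \<open>\<mu> (p n) (q n) t\<close> is continuous in \<open>t\<close>, and by monotonicity there are such times in every
  interval.\<close>

lemma (in fuzzy_metric_space) nearness_forced_by_F2:
  assumes p: "\<And>n. p n \<in> X" and q: "\<And>n. q n \<in> X" and r: "\<And>n. r n \<in> X"
    and qr: "\<And>t. t > 0 \<Longrightarrow> (\<lambda>n. \<mu> (q n) (r n) t) \<longlonglongrightarrow> 1"
    and F: "continuous_on unit_cube6 F" "property_F2 F"
    and le: "\<And>n t. t > 0 \<Longrightarrow> F (\<mu> (p n) (q n) t, \<mu> (q n) (r n) t, \<mu> (p n) (q n) t,
      \<mu> (q n) (r n) t, 1, \<mu> (p n) (r n) t) \<le> 1"
    and "t > 0"
  shows "(\<lambda>n. \<mu> (p n) (q n) t) \<longlonglongrightarrow> 1"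
proof -
  \<comment> \<open>\<open>L t\<close> is the lower limit of \<open>\<mu> (p n) (q n) t\<close>, written as the supremum of its eventual lower
    bounds so that it is a real number.\<close>
  define C where "C t = {c. \<forall>\<^sub>F n in sequentially. c \<le> \<mu> (p n) (q n) t}" for t
  define L where "L t = Sup (C t)" for t
  have C0: "0 \<in> C t" if "t > 0" for t
    using in_unit[OF p q that] by (simp add: C_def)
  have C1: "c \<le> 1" if "t > 0" "c \<in> C t" for t c
  proof -
    from that(2) obtain n where "c \<le> \<mu> (p n) (q n) t"
      unfolding C_def using eventually_happens by fastforce
    then show ?thesis using le_one[OF p[of n] q[of n] that(1)] by simp
  qed
  have bdd: "bdd_above (C t)" if "t > 0" for t
    using C1[OF that] by (auto simp: bdd_above_def)
  have L_less: "\<forall>\<^sub>F n in sequentially. c < \<mu> (p n) (q n) t" if t: "t > 0" and c: "c < L t" for t c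
  proof -
    obtain d where "d \<in> C t" "c < d"
      using c less_cSup_iff[OF _ bdd[OF t]] C0[OF t] unfolding L_def by blast
    then show ?thesis unfolding C_def by (auto elim: eventually_mono)
  qed
  have less_L: "\<exists>\<^sub>F n in sequentially. \<mu> (p n) (q n) t < c" if t: "t > 0" and c: "L t < c" for t c
  proof (rule ccontr)
    assume "\<not> ?thesis"
    then have "c \<in> C t" by (simp add: C_def not_frequently not_less)
    then have "c \<le> L t" unfolding L_def using bdd[OF t] by (rule cSup_upper)
    with c show False by simp
  qed
  have L_range: "L t \<in> {0..1}" if "t > 0" for t
    using C0 C1 bdd that unfolding L_def by (auto intro: cSup_upper cSup_least)
  have L_mono: "L s \<le> L t" if "0 < s" "s \<le> t" for s t
  proof -
    have "C s \<subseteq> C t"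
      unfolding C_def using mono_time[OF p q that] by (auto elim!: eventually_mono intro: order_trans)
    then show ?thesis
      unfolding L_def using C0 bdd that by (intro cSup_subset_mono) auto
  qed
  have L_one: "L t = 1" if t: "t > 0" and cont: "isCont L t" for t
  proof -
    \<comment> \<open>Choosing indices where \<open>\<mu> (p n) (q n)\<close> is almost minimal at the later time \<open>t + s\<close>, rather
      than at \<open>t\<close>, also bounds \<open>\<mu> (p n) (r n) t\<close> from above; the lower bounds hold for almost all
      indices anyway.\<close>
    have "\<exists>n. \<bar>\<mu> (p n) (q n) t - L t\<bar> < e \<and> \<bar>\<mu> (p n) (r n) t - L t\<bar> < e \<and>
        \<bar>\<mu> (q n) (r n) t - 1\<bar> < e" if "e > 0" for e
    proof -
      obtain d where "d > 0" and d: "\<And>t'. \<bar>t' - t\<bar> < d \<Longrightarrow> \<bar>L t' - L t\<bar> < e/2"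
        using cont \<open>e > 0\<close> unfolding continuous_at_eps_delta
        by (metis dist_real_def half_gt_zero)
      define s where "s = min d t / 2"
      have s: "0 < s" "s < t" "s < d" using \<open>d > 0\<close> t by (auto simp: s_def)
      have rq: "(\<lambda>n. \<mu> (r n) (q n) s) \<longlonglongrightarrow> 1"
        using qr[OF s(1)] sym[OF q r s(1)] by simp
      have "L (t + s) < L t + e/2" "L t - e/2 < L (t - s)"
        using d[of "t + s"] d[of "t - s"] s by (auto simp: abs_if split: if_splits)
      then have "\<exists>\<^sub>F n in sequentially. \<mu> (p n) (q n) (t + s) < L t + e/2"
        and "\<forall>\<^sub>F n in sequentially. L t - e/2 < \<mu> (p n) (q n) (t - s)"
        using less_L L_less s t by auto
      moreover have "\<forall>\<^sub>F n in sequentially. \<mu> (p n) (q n) (t - s) - e/2 < \<mu> (p n) (r n) (t - s + s)"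
        using p q r qr s \<open>e > 0\<close> by (intro eventually_replace_right) auto
      moreover have "\<forall>\<^sub>F n in sequentially. \<mu> (p n) (r n) t - e/2 < \<mu> (p n) (q n) (t + s)"
        using p q r rq s t \<open>e > 0\<close> by (intro eventually_replace_right) auto
      moreover have "\<forall>\<^sub>F n in sequentially. 1 - e < \<mu> (q n) (r n) t"
        using qr[OF t] \<open>e > 0\<close> by (intro order_tendstoD(1)) auto
      ultimately have "\<exists>\<^sub>F n in sequentially.
          \<mu> (p n) (q n) (t + s) < L t + e/2 \<and> L t - e/2 < \<mu> (p n) (q n) (t - s) \<and>
          \<mu> (p n) (q n) (t - s) - e/2 < \<mu> (p n) (r n) (t - s + s) \<and>
          \<mu> (p n) (r n) t - e/2 < \<mu> (p n) (q n) (t + s) \<and> 1 - e < \<mu> (q n) (r n) t"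
        by (intro frequently_eventually_frequently eventually_conj)
      then obtain n where
          "\<mu> (p n) (q n) (t + s) < L t + e/2" "L t - e/2 < \<mu> (p n) (q n) (t - s)"
          "\<mu> (p n) (q n) (t - s) - e/2 < \<mu> (p n) (r n) t"
          "\<mu> (p n) (r n) t - e/2 < \<mu> (p n) (q n) (t + s)" "1 - e < \<mu> (q n) (r n) t"
        using frequently_ex by fastforce
      moreover have "\<mu> (p n) (q n) (t - s) \<le> \<mu> (p n) (q n) t"
          "\<mu> (p n) (q n) t \<le> \<mu> (p n) (q n) (t + s)" "\<mu> (q n) (r n) t \<le> 1"
        using mono_time[OF p q] le_one[OF q r t] s t by auto
      ultimately have "\<bar>\<mu> (p n) (q n) t - L t\<bar> < e" "\<bar>\<mu> (p n) (r n) t - L t\<bar> < e"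
          "\<bar>\<mu> (q n) (r n) t - 1\<bar> < e"
        using \<open>e > 0\<close> by (simp_all add: abs_less_iff)
      then show ?thesis by blast
    qed
    then have "\<exists>n. \<bar>\<mu> (p n) (q n) t - L t\<bar> < inverse (Suc k) \<and>
        \<bar>\<mu> (p n) (r n) t - L t\<bar> < inverse (Suc k) \<and>
        \<bar>\<mu> (q n) (r n) t - 1\<bar> < inverse (Suc k)" for k
      by simp
    then obtain N where N: "\<And>k. \<bar>\<mu> (p (N k)) (q (N k)) t - L t\<bar> < inverse (Suc k)"
        "\<And>k. \<bar>\<mu> (p (N k)) (r (N k)) t - L t\<bar> < inverse (Suc k)"
        "\<And>k. \<bar>\<mu> (q (N k)) (r (N k)) t - 1\<bar> < inverse (Suc k)"
      by metis
    have tendsto: "u \<longlonglongrightarrow> l" if "\<And>k. \<bar>u k - l\<bar> < inverse (Suc k)" for u :: "nat \<Rightarrow> real" and l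
    proof (rule Lim_null_comparison[THEN LIM_zero_cancel])
      show "\<forall>\<^sub>F k in sequentially. norm (u k - l) \<le> inverse (Suc k)"
        using that by (auto intro!: always_eventually less_imp_le)
    qed (rule LIMSEQ_inverse_real_of_nat)
    have "F (L t, 1, L t, 1, 1, L t) \<le> 1"
    proof (rule implicit_inequality_limit[OF F(1)])
      show "F (\<mu> (p (N k)) (q (N k)) t, \<mu> (q (N k)) (r (N k)) t, \<mu> (p (N k)) (q (N k)) t,
          \<mu> (q (N k)) (r (N k)) t, 1, \<mu> (p (N k)) (r (N k)) t) \<le> 1" for k
        by (rule le[OF t])
      show "(\<mu> (p (N k)) (q (N k)) t, \<mu> (q (N k)) (r (N k)) t, \<mu> (p (N k)) (q (N k)) t,
          \<mu> (q (N k)) (r (N k)) t, 1, \<mu> (p (N k)) (r (N k)) t) \<in> unit_cube6" for k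
        using in_unit[OF p q t] in_unit[OF q r t] in_unit[OF p r t] by simp
    qed (rule tendsto N tendsto_const)+
    moreover have "F (L t, 1, L t, 1, 1, L t) > 1" if "L t \<noteq> 1"
      using F(2) L_range[OF t] that unfolding property_F2_def by simp
    ultimately show ?thesis
      by fastforce
  qed
  have "countable {s \<in> {0<..}. \<not> continuous (at s within {0<..}) L}"
    using L_mono by (intro mono_on_ctble_discont) (auto simp: monotone_on_def)
  moreover have "uncountable {0<..<t}"
    using \<open>t > 0\<close> by (simp add: uncountable_open_interval)
  ultimately have "\<not> {0<..<t} \<subseteq> {s \<in> {0<..}. \<not> continuous (at s within {0<..}) L}"
    using countable_subset by blast
  then obtain s where s: "0 < s" "s < t" and "continuous (at s within {0<..}) L"
    by auto
  then have "isCont L s"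
    by (metis at_within_open greaterThan_iff open_greaterThan)
  then have "L s = 1" using L_one s by simp
  then have "L t \<ge> 1" using L_mono[of s t] s by simp
  show ?thesis
  proof (rule order_tendstoI)
    show "\<forall>\<^sub>F n in sequentially. c < \<mu> (p n) (q n) t" if "c < 1" for c
      using L_less[OF \<open>t > 0\<close>] that \<open>L t \<ge> 1\<close> by simp
    show "\<forall>\<^sub>F n in sequentially. \<mu> (p n) (q n) t < c" if "1 < c" for c
      using le_one[OF p q \<open>t > 0\<close>] that by (auto intro!: always_eventually intro: le_less_trans)
  qed
qed

section \<open>Two pairs of maps with an implicit contractive inequality\<close>

locale implicit_contraction = fuzzy_metric_space X \<mu> star
  for X :: "'a set" and \<mu> :: "'a \<Rightarrow> 'a \<Rightarrow> real \<Rightarrow> real"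
    and star :: "real \<Rightarrow> real \<Rightarrow> real" (infixl "\<ast>" 70) +
  fixes A B S T :: "'a \<Rightarrow> 'a" and F :: "real6 \<Rightarrow> real"
  assumes A_in: "x \<in> X \<Longrightarrow> A x \<in> X" and B_in: "x \<in> X \<Longrightarrow> B x \<in> X"
    and S_in: "x \<in> X \<Longrightarrow> S x \<in> X" and T_in: "x \<in> X \<Longrightarrow> T x \<in> X"
    and A_range: "A ` X \<subseteq> T ` X" and B_range: "B ` X \<subseteq> S ` X"
    and F_continuous: "continuous_on unit_cube6 F"
    and F1: "property_F1 F" and F2: "property_F2 F" and F3: "property_F3 F"
    and contractive: "x \<in> X \<Longrightarrow> y \<in> X \<Longrightarrow> t > 0 \<Longrightarrow>
      F (\<mu> (A x) (B y) t, \<mu> (S x) (T y) t, \<mu> (A x) (S x) t,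
         \<mu> (B y) (T y) t, \<mu> (S x) (B y) t, \<mu> (A x) (T y) t) \<le> 1"
begin

lemma exchange_pairs:
  "implicit_contraction X \<mu> star B A T S (\<lambda>(a, b, c, d, e, f). F (a, b, d, c, f, e))"
proof unfold_locales
  show "continuous_on unit_cube6 (\<lambda>(a, b, c, d, e, f). F (a, b, d, c, f, e))"
    unfolding case_prod_beta
    by (rule continuous_on_compose2[OF F_continuous]) (auto intro!: continuous_intros)
  show "(case (\<mu> (B x) (A y) t, \<mu> (T x) (S y) t, \<mu> (B x) (T x) t,
      \<mu> (A y) (S y) t, \<mu> (T x) (A y) t, \<mu> (B x) (S y) t) of
      (a, b, c, d, e, f) \<Rightarrow> F (a, b, d, c, f, e)) \<le> 1"
    if "x \<in> X" "y \<in> X" "t > 0" for x y t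
    using contractive[of y x t] that sym[of "B x" "A y" t] sym[of "T x" "S y" t]
      sym[of "T x" "A y" t] sym[of "B x" "S y" t] A_in B_in S_in T_in by simp
qed (use A_in B_in S_in T_in A_range B_range F1 F2 F3 in
      \<open>auto simp: property_F1_def property_F2_def property_F3_def\<close>)

definition common_limit :: "'a \<Rightarrow> bool" where
  "common_limit z \<longleftrightarrow> z \<in> X \<and> (\<exists>x y. (\<forall>n. x n \<in> X) \<and> (\<forall>n. y n \<in> X) \<and>
    fuzzy_converges \<mu> (\<lambda>n. A (y n)) z \<and> fuzzy_converges \<mu> (\<lambda>n. S (y n)) z \<and>
    fuzzy_converges \<mu> (\<lambda>n. B (x n)) z \<and> fuzzy_converges \<mu> (\<lambda>n. T (x n)) z)"

lemma common_limit_of_EA: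
  assumes "property_EA X \<mu> B T"
  shows "\<exists>z. common_limit z"
proof -
  obtain x z where x: "\<And>n. x n \<in> X" and z: "z \<in> X"
    and B: "fuzzy_converges \<mu> (\<lambda>n. B (x n)) z" and T: "fuzzy_converges \<mu> (\<lambda>n. T (x n)) z"
    using assms unfolding property_EA_def by blast
  have "\<exists>y\<in>X. B (x n) = S y" for n
    using B_range x by blast
  then obtain y where y: "\<And>n. y n \<in> X" and By: "\<And>n. B (x n) = S (y n)"
    by metis
  have near: "(\<lambda>n. \<mu> (A (y n)) (S (y n)) t) \<longlonglongrightarrow> 1" if "t > 0" for t
  proof (rule nearness_forced_by_F2[OF _ _ _ _ F_continuous F2])
    show "(\<lambda>n. \<mu> (S (y n)) (T (x n)) s) \<longlonglongrightarrow> 1" if "s > 0" for s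
      using tendsto_one_of_common_limit[OF _ _ z B T that] B_in[OF x] T_in[OF x] by (simp add: By)
    show "F (\<mu> (A (y n)) (S (y n)) s, \<mu> (S (y n)) (T (x n)) s, \<mu> (A (y n)) (S (y n)) s,
        \<mu> (S (y n)) (T (x n)) s, 1, \<mu> (A (y n)) (T (x n)) s) \<le> 1" if "s > 0" for n s
      using contractive[OF y x that, of n n] eq_one_iff[of "S (y n)" "S (y n)" s] that y S_in
      by (simp add: By)
  qed (use x y A_in S_in T_in that in auto)
  have S: "fuzzy_converges \<mu> (\<lambda>n. S (y n)) z"
    using B by (simp add: By)
  have "fuzzy_converges \<mu> (\<lambda>n. A (y n)) z"
    unfolding fuzzy_converges_def
  proof (intro allI impI)
    fix t :: real assume "t > 0"
    show "(\<lambda>n. \<mu> (A (y n)) z t) \<longlonglongrightarrow> 1"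
    proof (rule tendsto_one_trans[where q = "\<lambda>n. S (y n)"])
      show "(\<lambda>n. \<mu> (S (y n)) z s) \<longlonglongrightarrow> 1" if "s > 0" for s
        using S that by (simp add: fuzzy_converges_def)
    qed (use near y z A_in S_in \<open>t > 0\<close> in auto)
  qed
  with S B T x y z show ?thesis
    unfolding common_limit_def by blast
qed

text \<open>The point \<open>A a\<close> does not vary with \<open>n\<close>, so the limit in the contractive inequality for \<open>a\<close> and
  \<open>x\<^sub>n\<close> can be taken directly; it has the shape forbidden by \<open>F\<^sub>2\<close>.\<close>

lemma coincidence_at_common_limit:
  assumes "common_limit z" "a \<in> X" "S a = z"
  shows "A a = z"
proof (rule ccontr)
  assume "A a \<noteq> z"
  obtain x where z: "z \<in> X" and x: "\<And>n. x n \<in> X"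
    and B: "fuzzy_converges \<mu> (\<lambda>n. B (x n)) z" and T: "fuzzy_converges \<mu> (\<lambda>n. T (x n)) z"
    using assms unfolding common_limit_def by blast
  define u where "u = \<mu> (A a) z 1"
  have in_X: "A a \<in> X" "\<And>n. B (x n) \<in> X" "\<And>n. T (x n) \<in> X"
    using assms x A_in B_in T_in by auto
  have zz: "\<mu> z z 1 = 1"
    using eq_one_iff z by simp
  have "F (u, 1, u, 1, 1, u) \<le> 1"
  proof (rule implicit_inequality_limit[OF F_continuous])
    show "F (\<mu> (A a) (B (x n)) 1, \<mu> z (T (x n)) 1, u, \<mu> (B (x n)) (T (x n)) 1,
        \<mu> z (B (x n)) 1, \<mu> (A a) (T (x n)) 1) \<le> 1" for n
      using contractive[of a "x n" 1] assms x by (simp add: u_def)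
    show "(\<mu> (A a) (B (x n)) 1, \<mu> z (T (x n)) 1, u, \<mu> (B (x n)) (T (x n)) 1,
        \<mu> z (B (x n)) 1, \<mu> (A a) (T (x n)) 1) \<in> unit_cube6" for n
      unfolding u_def mem_Times_iff fst_conv snd_conv
      using in_X z by (intro conjI in_unit) auto
    show "(\<lambda>n. \<mu> (A a) (B (x n)) 1) \<longlonglongrightarrow> u" "(\<lambda>n. \<mu> (A a) (T (x n)) 1) \<longlonglongrightarrow> u"
      unfolding u_def using in_X z B T by (auto intro: tendsto_of_converges)
    show "(\<lambda>n. \<mu> z (T (x n)) 1) \<longlonglongrightarrow> 1" "(\<lambda>n. \<mu> z (B (x n)) 1) \<longlonglongrightarrow> 1"
      using tendsto_of_converges[OF z _ z T] tendsto_of_converges[OF z _ z B] in_X zz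
      by (metis zero_less_one)+
    show "(\<lambda>n. \<mu> (B (x n)) (T (x n)) 1) \<longlonglongrightarrow> 1"
      using in_X z B T by (intro tendsto_one_of_common_limit) auto
  qed simp
  moreover have "u \<in> {0..<1}"
    using in_unit[of "A a" z 1] eq_one_iff[of "A a" z 1] \<open>A a \<noteq> z\<close> in_X z
    by (simp add: u_def less_le)
  ultimately show False
    using F2 unfolding property_F2_def by fastforce
qed

lemma coincidence_values_equal:
  assumes "a \<in> X" "b \<in> X" "A a = S a" "B b = T b"
  shows "A a = B b"
proof (rule ccontr)
  assume "A a \<noteq> B b"
  have in_X: "S a \<in> X" "T b \<in> X"
    using assms S_in T_in by auto
  define u where "u = \<mu> (S a) (T b) 1"
  have "F (u, u, 1, 1, u, u) \<le> 1"
    using contractive[of a b 1] assms in_X eq_one_iff[of "S a" "S a" 1] eq_one_iff[of "T b" "T b" 1]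
    by (simp add: u_def)
  moreover have "u \<in> {0..<1}"
    using in_unit[of "S a" "T b" 1] eq_one_iff[of "S a" "T b" 1] \<open>A a \<noteq> B b\<close> in_X assms
    by (simp add: u_def less_le)
  ultimately show False
    using F3 unfolding property_F3_def by fastforce
qed

lemma common_limit_in_ranges:
  assumes "common_limit z"
    and "fuzzy_closed X \<mu> (A ` X) \<or> fuzzy_closed X \<mu> (B ` X) \<or>
      fuzzy_closed X \<mu> (S ` X) \<or> fuzzy_closed X \<mu> (T ` X)"
  shows "z \<in> S ` X \<or> z \<in> T ` X"
proof -
  obtain x y where "z \<in> X" and x: "\<forall>n. x n \<in> X" and y: "\<forall>n. y n \<in> X"
    and lim: "fuzzy_converges \<mu> (\<lambda>n. A (y n)) z" "fuzzy_converges \<mu> (\<lambda>n. S (y n)) z"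
      "fuzzy_converges \<mu> (\<lambda>n. B (x n)) z" "fuzzy_converges \<mu> (\<lambda>n. T (x n)) z"
    using assms(1) unfolding common_limit_def by blast
  have in_range: "z \<in> G ` X"
    if closed: "fuzzy_closed X \<mu> (G ` X)" and w: "\<forall>n. w n \<in> X"
      and conv: "fuzzy_converges \<mu> (\<lambda>n. G (w n)) z" for G w
  proof -
    have "\<forall>n. G (w n) \<in> G ` X" using w by simp
    then show ?thesis
      using closed conv \<open>z \<in> X\<close> unfolding fuzzy_closed_def by auto
  qed
  have "z \<in> A ` X \<or> z \<in> B ` X \<or> z \<in> S ` X \<or> z \<in> T ` X"
    using assms(2) in_range[OF _ y lim(1)] in_range[OF _ x lim(3)] in_range[OF _ y lim(2)]
      in_range[OF _ x lim(4)] by argo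
  then show ?thesis
    using A_range B_range by blast
qed

end

section \<open>The common fixed point\<close>

theorem theorem4p2:
  fixes X :: "'a set" and \<mu> :: "'a \<Rightarrow> 'a \<Rightarrow> real \<Rightarrow> real"
    and star :: "real \<Rightarrow> real \<Rightarrow> real"
    and A B S T :: "'a \<Rightarrow> 'a" and F :: "real6 \<Rightarrow> real"
  assumes "fuzzy_metric_space X \<mu> star"
    and "A \<in> X \<rightarrow> X" and "B \<in> X \<rightarrow> X" and "S \<in> X \<rightarrow> X" and "T \<in> X \<rightarrow> X"
    and "A ` X \<subseteq> T ` X" and "B ` X \<subseteq> S ` X"
    and "continuous_on unit_cube6 F"
    and "property_F1 F" and "property_F2 F" and "property_F3 F"
    and "\<And>x y t. x \<in> X \<Longrightarrow> y \<in> X \<Longrightarrow> t > 0 \<Longrightarrow>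
      F (\<mu> (A x) (B y) t, \<mu> (S x) (T y) t, \<mu> (A x) (S x) t,
         \<mu> (B y) (T y) t, \<mu> (S x) (B y) t, \<mu> (A x) (T y) t) \<le> 1"
    and "property_EA X \<mu> A S \<or> property_EA X \<mu> B T"
    and "weakly_compatible X A S" and "weakly_compatible X B T"
    and "fuzzy_closed X \<mu> (A ` X) \<or> fuzzy_closed X \<mu> (B ` X) \<or>
      fuzzy_closed X \<mu> (S ` X) \<or> fuzzy_closed X \<mu> (T ` X)"
  shows "\<exists>!z. z \<in> X \<and> A z = z \<and> B z = z \<and> S z = z \<and> T z = z"
proof -
  interpret implicit_contraction X \<mu> star A B S T F
    using assms by (intro implicit_contraction.intro implicit_contraction_axioms.intro) auto
  interpret exch: implicit_contraction X \<mu> star B A T S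
      "\<lambda>(a, b, c, d, e, f). F (a, b, d, c, f, e)"
    by (rule exchange_pairs)
  have exch_limit: "exch.common_limit z \<longleftrightarrow> common_limit z" for z
    unfolding common_limit_def exch.common_limit_def by blast
  obtain z where z: "common_limit z"
    using assms(13) common_limit_of_EA exch.common_limit_of_EA exch_limit by blast
  then have "z \<in> X"
    by (simp add: common_limit_def)
  have SA: "A a = z" if "a \<in> X" "S a = z" for a
    using coincidence_at_common_limit z that by blast
  have TB: "B b = z" if "b \<in> X" "T b = z" for b
    using exch.coincidence_at_common_limit exch_limit z that by blast
  have S_to_T: "z \<in> T ` X" if "z \<in> S ` X"
  proof -
    from that obtain a where "a \<in> X" "z = S a" by (rule imageE)
    then have "z \<in> A ` X" using SA[of a] by (metis imageI)
    then show ?thesis using A_range by auto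
  qed
  have T_to_S: "z \<in> S ` X" if "z \<in> T ` X"
  proof -
    from that obtain b where "b \<in> X" "z = T b" by (rule imageE)
    then have "z \<in> B ` X" using TB[of b] by (metis imageI)
    then show ?thesis using B_range by auto
  qed
  have "z \<in> S ` X" "z \<in> T ` X"
    using common_limit_in_ranges[OF z assms(16)] S_to_T T_to_S by argo+
  then obtain a b where a: "a \<in> X" "S a = z" and b: "b \<in> X" "T b = z"
    by (metis imageE)
  note Aa = SA[OF a] and Bb = TB[OF b]
  have Az: "A z = S z"
    using assms(14) a Aa unfolding weakly_compatible_def by metis
  have Bz: "B z = T z"
    using assms(15) b Bb unfolding weakly_compatible_def by metis
  have "A z = z" "B z = z"
    using coincidence_values_equal[of z b] coincidence_values_equal[of a z]
      \<open>z \<in> X\<close> a b Aa Bb Az Bz by auto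
  then have "z \<in> X \<and> A z = z \<and> B z = z \<and> S z = z \<and> T z = z"
    using \<open>z \<in> X\<close> Az Bz by simp
  moreover have "w = z" if "w \<in> X \<and> A w = w \<and> B w = w \<and> S w = w \<and> T w = w" for w
    using coincidence_values_equal[of w z] that \<open>z \<in> X\<close> Bz \<open>B z = z\<close> by simp
  ultimately show ?thesis
    by blast
qed

end
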